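(* Let $X=\{x_1,\ldots,x_n\}\subset[\Delta]^d$ be a sequence of points and let $z\ge 1$. For each $t\in[n]$ let $\sigma_t$ denote the online sensitivity of $x_t$ for $(k,z)$-clustering. Then \[\sum_{t=1}^n\sigma_t=O\left(2^{2z}k\log^2(nd\Delta)\right).\]
   Context: $[n]=\{1,\ldots,n\}$ and $[\Delta]=\{1,\ldots,\Delta\}$; distances are Euclidean, $\mathrm{dist}(x,C)=\min_{c\in C}\|x-c\|_2$. For $t\in[n]$ let $X_t=\{x_1,\ldots,x_t\}$. The online sensitivity of $x_t$ for $(k,z)$-clustering is \[\sigma_t=\max_{C\subset\mathbb{R}^d,\,|C|\le k}\frac{\mathrm{dist}(x_t,C)^z}{\sum_{i=1}^t\mathrm{dist}(x_i,C)^z}.\] *)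

theory Defs
  imports "HOL-Analysis.Analysis"
begin

text \<open>
  The constant hidden in the O-notation must not depend on the dimension, so the dimension
  \<open>d\<close> is a natural number rather than a type: a point of \<open>\<real>\<^sup>d\<close> is a function
  \<open>nat \<Rightarrow> real\<close> vanishing at all indices \<open>i \<ge> d\<close>, i.e. an element of
  \<^term>\<open>topspace (Euclidean_space d)\<close>, with coordinates indexed by \<open>i < d\<close>.
\<close>

definition eucl_dist :: "nat \<Rightarrow> (nat \<Rightarrow> real) \<Rightarrow> (nat \<Rightarrow> real) \<Rightarrow> real" where
  "eucl_dist d x y = L2_set (\<lambda>i. x i - y i) {..<d}"

text \<open>Used only for finite nonempty \<open>C\<close>.\<close>

definition dist_to_set :: "nat \<Rightarrow> (nat \<Rightarrow> real) \<Rightarrow> (nat \<Rightarrow> real) set \<Rightarrow> real" where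
  "dist_to_set d x C = Min ((\<lambda>c. eucl_dist d x c) ` C)"

definition center_sets :: "nat \<Rightarrow> nat \<Rightarrow> (nat \<Rightarrow> real) set set" where
  "center_sets d k =
     {C. C \<subseteq> topspace (Euclidean_space d) \<and> finite C \<and> C \<noteq> {} \<and> card C \<le> k}"

definition grid :: "nat \<Rightarrow> nat \<Rightarrow> (nat \<Rightarrow> real) set" where
  "grid d \<Delta> = {x \<in> topspace (Euclidean_space d). \<forall>i<d. x i \<in> real ` {1..\<Delta>}}"

text \<open>
  The maximum in the definition of the online sensitivity need not be attained (for the points
  1, 3, 2 on the line, with \<open>k = 1\<close> and \<open>z = 2\<close>, the ratio for \<open>t = 3\<close> approaches 1/3 as the
  center tends to infinity), so it is read as a supremum.  All ratios lie between 0 and 1; a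
  ratio 0/0 counts as 0 and hence does not affect the supremum.
\<close>

definition online_sensitivity ::
    "nat \<Rightarrow> nat \<Rightarrow> real \<Rightarrow> (nat \<Rightarrow> nat \<Rightarrow> real) \<Rightarrow> nat \<Rightarrow> real" where
  "online_sensitivity d k z x t =
     (SUP C \<in> center_sets d k.
        dist_to_set d (x t) C powr z / (\<Sum>i=1..t. dist_to_set d (x i) C powr z))"

end

theory Submission
  imports Defs
begin

text \<open>
  Let \<open>G = (4/3)\<^sup>z\<close> and group the times \<open>t\<close> into phases according to the power of \<open>G\<close> (times
  \<open>2\<^sup>-\<^sup>z\<close>) just above the optimal clustering cost of the first \<open>t\<close> points. A nonzero optimal cost
  lies between \<open>2\<^sup>-\<^sup>z\<close> and \<open>n (d \<Delta>)\<^sup>z\<close>, so there are \<open>O(log (n d \<Delta>))\<close> phases. Within a phase, fix a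
  clustering \<open>D\<close> of cost \<open>A\<close> that is nearly optimal at the end of the phase; \<open>A\<close> is at most \<open>G\<close> times
  the cost of any \<open>C\<close> at any time of the phase. Comparing \<open>x\<^sub>t\<close> with the points that precede it in its
  \<open>D\<close>-cluster, whose number up to time \<open>t\<close> is \<open>N\<^sub>t\<close>, the triangle inequality gives
  \<open>\<sigma>\<^sub>t \<le> 3\<^sup>z (G dist(x\<^sub>t,D)\<^sup>z / A + (G + 1) / N\<^sub>t)\<close>. The first terms add up to at most \<open>G\<close>, and the
  terms \<open>1 / N\<^sub>t\<close> to at most \<open>k\<close> harmonic sums. The base \<open>4/3\<close> makes \<open>3\<^sup>z G = 2\<^sup>2\<^sup>z\<close>, while growth
  exponential in \<open>z\<close> keeps the number of phases independent of \<open>z\<close>.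
\<close>

section \<open>Distances to points and to center sets\<close>

lemma eucl_dist_nonneg: "0 \<le> eucl_dist d x y"
  by (simp add: eucl_dist_def L2_set_nonneg)

lemma eucl_dist_commute: "eucl_dist d x y = eucl_dist d y x"
  by (simp add: eucl_dist_def L2_set_def power2_commute)

lemma eucl_dist_triangle: "eucl_dist d x z \<le> eucl_dist d x y + eucl_dist d y z"
  using L2_set_triangle_ineq[of "\<lambda>i. x i - y i" "\<lambda>i. y i - z i" "{..<d}"]
  by (simp add: eucl_dist_def)

lemma dist_to_set_le:
  assumes "C \<in> center_sets d k" "c \<in> C"
  shows "dist_to_set d x C \<le> eucl_dist d x c"
  using assms by (auto simp: dist_to_set_def center_sets_def)

lemma dist_to_set_attained:
  assumes "C \<in> center_sets d k"
  obtains c where "c \<in> C" "dist_to_set d x C = eucl_dist d x c"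
proof -
  have "dist_to_set d x C \<in> (\<lambda>c. eucl_dist d x c) ` C"
    unfolding dist_to_set_def using assms by (intro Min_in) (auto simp: center_sets_def)
  then show ?thesis
    using that by auto
qed

lemma dist_to_set_nonneg:
  assumes "C \<in> center_sets d k"
  shows "0 \<le> dist_to_set d x C"
  by (metis assms dist_to_set_attained eucl_dist_nonneg)

lemma dist_to_set_triangle:
  assumes "C \<in> center_sets d k"
  shows "dist_to_set d x C \<le> eucl_dist d x y + dist_to_set d y C"
proof -
  obtain c where c: "c \<in> C" "dist_to_set d y C = eucl_dist d y c"
    by (rule dist_to_set_attained[OF assms])
  then show ?thesis
    using dist_to_set_le[OF assms c(1), of x] eucl_dist_triangle[of d x c y] by simp
qed

section \<open>Sensitivities relative to one fixed clustering\<close>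

lemma powr_add3_le:
  fixes a b c z :: real
  assumes "0 \<le> a" "0 \<le> b" "0 \<le> c" "0 \<le> z"
  shows "(a + b + c) powr z \<le> 3 powr z * (a powr z + b powr z + c powr z)"
proof -
  define m where "m = max a (max b c)"
  have "(a + b + c) powr z \<le> (3 * m) powr z"
    using assms by (intro powr_mono2) (auto simp: m_def)
  also have "\<dots> = 3 powr z * m powr z"
    using assms by (intro powr_mult)
  also have "m powr z \<le> a powr z + b powr z + c powr z"
    by (auto simp: m_def max_def)
  finally show ?thesis
    by (simp add: mult_left_mono)
qed

text \<open>On a fibre of \<open>c\<close> the denominators are the ranks of its elements, hence
  distinct numbers in \<open>{1..m}\<close>. Each of the at most \<open>k\<close> fibres thus
  contributes at most a harmonic sum.\<close>

lemma sum_inverse_rank_le: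
  fixes c :: "nat \<Rightarrow> 'a"
  assumes "finite D" "card D \<le> k" "c ` {1..m} \<subseteq> D" "1 \<le> m"
  shows "(\<Sum>t=1..m. 1 / real (card {i\<in>{1..t}. c i = c t})) \<le> real k * (1 + ln (real m))"
proof -
  define N where "N t = card {i\<in>{1..t}. c i = c t}" for t
  have fibre: "(\<Sum>t\<in>{t\<in>{1..m}. c t = y}. 1 / real (N t)) \<le> 1 + ln (real m)" for y
  proof -
    let ?F = "{t\<in>{1..m}. c t = y}"
    have less: "N s < N t" if "s \<in> ?F" "t \<in> ?F" "s < t" for s t
      unfolding N_def
    proof (rule psubset_card_mono)
      have "t \<in> {i\<in>{1..t}. c i = c t}" "t \<notin> {i\<in>{1..s}. c i = c s}"
        using that by auto
      moreover have "{i\<in>{1..s}. c i = c s} \<subseteq> {i\<in>{1..t}. c i = c t}"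
        using that by auto
      ultimately show "{i\<in>{1..s}. c i = c s} \<subset> {i\<in>{1..t}. c i = c t}"
        by blast
    qed simp
    have inj: "inj_on N ?F"
      by (intro linorder_inj_onI' less_imp_neq less)
    have rng: "N ` ?F \<subseteq> {1..m}"
    proof
      fix v assume "v \<in> N ` ?F"
      then obtain t where t: "t \<in> ?F" "v = N t"
        by blast
      have "N t \<le> card {1..t}"
        unfolding N_def by (intro card_mono) auto
      moreover have "card {t} \<le> N t"
        unfolding N_def using t by (intro card_mono) auto
      ultimately show "v \<in> {1..m}"
        using t by auto
    qed
    have "(\<Sum>t\<in>?F. 1 / real (N t)) = (\<Sum>v\<in>N ` ?F. 1 / real v)"
      using inj by (simp add: sum.reindex)
    also have "\<dots> \<le> (\<Sum>v\<in>{1..m}. 1 / real v)"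
      using rng by (intro sum_mono2) auto
    also have "\<dots> = harm m"
      by (simp add: harm_def inverse_eq_divide)
    \<comment> \<open>\<open>harm m - ln m\<close> is decreasing in \<open>m\<close> and equals 1 at
      \<open>m = 1\<close>.\<close>
    also have "\<dots> \<le> 1 + ln (real m)"
      using euler_mascheroni_sequence_decreasing[of 1 m] assms by (simp add: harm_expand)
    finally show ?thesis .
  qed
  have "(\<Sum>t=1..m. 1 / real (N t)) = (\<Sum>y\<in>D. \<Sum>t\<in>{t\<in>{1..m}. c t = y}. 1 / real (N t))"
    using assms by (intro sum.group[symmetric]) auto
  also have "\<dots> \<le> (\<Sum>y\<in>D. 1 + ln (real m))"
    by (intro sum_mono fibre)
  also have "\<dots> \<le> real k * (1 + ln (real m))"
    using assms by (auto intro!: mult_right_mono)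
  finally show ?thesis
    by (simp add: N_def)
qed

text \<open>The estimate for a single phase: \<open>T\<close> holds its times, \<open>m\<close>
  bounds them, and \<open>\<rho>\<close> limits the growth of the optimal cost during the
  phase.\<close>

lemma sum_online_sensitivity_le:
  assumes D: "D \<in> center_sets d k" and z: "0 \<le> z" and rho: "0 \<le> \<rho>"
    and T: "T \<subseteq> {1..m}" and m: "1 \<le> m"
    and opt: "\<And>t C. t \<in> T \<Longrightarrow> C \<in> center_sets d k \<Longrightarrow>
      (\<Sum>i=1..m. dist_to_set d (x i) D powr z) \<le> \<rho> * (\<Sum>i=1..t. dist_to_set d (x i) C powr z)"
  shows "(\<Sum>t\<in>T. online_sensitivity d k z x t)
    \<le> 3 powr z * (\<rho> + (\<rho> + 1) * (real k * (1 + ln (real m))))"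
proof -
  define A where "A = (\<Sum>i=1..m. dist_to_set d (x i) D powr z)"
  have "\<forall>i. \<exists>y. y \<in> D \<and> dist_to_set d (x i) D = eucl_dist d (x i) y"
    by (metis D dist_to_set_attained)
  then obtain c where c: "\<And>i. c i \<in> D" "\<And>i. dist_to_set d (x i) D = eucl_dist d (x i) (c i)"
    by metis
  define a where "a i = dist_to_set d (x i) D" for i
  have a0: "0 \<le> a i" for i
    by (simp add: a_def dist_to_set_nonneg[OF D])
  \<comment> \<open>For \<open>t \<ge> 1\<close> the set \<open>I t\<close> contains
    \<open>t\<close> itself, so \<open>N t\<close> is positive; it is the rank of \<open>t\<close>
    within its cluster.\<close>
  define I where "I t = {i\<in>{1..t}. c i = c t}" for t
  define N where "N t = real (card (I t))" for t
  have A0: "0 \<le> A"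
    unfolding A_def by (intro sum_nonneg) auto
  have pointwise: "online_sensitivity d k z x t
      \<le> 3 powr z * (\<rho> * (a t powr z / A) + (\<rho> + 1) * (1 / N t))" if t: "t \<in> T" for t
    unfolding online_sensitivity_def
  proof (rule cSUP_least)
    show "center_sets d k \<noteq> {}"
      using D by auto
  next
    fix C assume C: "C \<in> center_sets d k"
    define S where "S = (\<Sum>i=1..t. dist_to_set d (x i) C powr z)"
    define s where "s = dist_to_set d (x t) C"
    have tm: "t \<in> {1..m}"
      using t T by blast
    have "t \<in> I t"
      using tm by (simp add: I_def)
    then have N: "0 < N t"
      unfolding N_def by (auto simp: card_gt_0_iff I_def)
    have S0: "0 \<le> S"
      unfolding S_def by (intro sum_nonneg) auto
    have AS: "A \<le> \<rho> * S"
      unfolding A_def S_def using opt[OF t C] .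
    \<comment> \<open>Go from \<open>x t\<close> to the common center \<open>c t = c i\<close>, on
      to \<open>x i\<close>, and then to the center of \<open>C\<close> nearest to
      \<open>x i\<close>.\<close>
    have each: "s powr z
        \<le> 3 powr z * (a t powr z + a i powr z + dist_to_set d (x i) C powr z)"
      if "i \<in> I t" for i
    proof -
      have "c i = c t"
        using that by (simp add: I_def)
      then have "s \<le> a t + a i + dist_to_set d (x i) C"
        using dist_to_set_triangle[OF C, of "x t" "x i"]
          eucl_dist_triangle[of d "x t" "x i" "c t"] eucl_dist_commute[of d "c t" "x i"]
        by (simp add: s_def a_def c(2))
      then have "s powr z \<le> (a t + a i + dist_to_set d (x i) C) powr z"
        using z dist_to_set_nonneg[OF C] by (intro powr_mono2) (auto simp: s_def)
      also have "\<dots> \<le> 3 powr z * (a t powr z + a i powr z + dist_to_set d (x i) C powr z)"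
        using z a0 dist_to_set_nonneg[OF C] by (intro powr_add3_le) auto
      finally show ?thesis .
    qed
    have IA: "(\<Sum>i\<in>I t. a i powr z) \<le> A"
      unfolding A_def a_def using tm by (intro sum_mono2) (auto simp: I_def)
    have IS: "(\<Sum>i\<in>I t. dist_to_set d (x i) C powr z) \<le> S"
      unfolding S_def by (intro sum_mono2) (auto simp: I_def)
    \<comment> \<open>Average \<open>each\<close> over \<open>I t\<close>: the terms
      \<open>a i powr z\<close> total at most \<open>A \<le> \<rho> * S\<close>, the distances to
      \<open>C\<close> at most \<open>S\<close>, which yields
      \<open>(\<rho> + 1) * S / N t\<close>.\<close>
    have "N t * s powr z = (\<Sum>i\<in>I t. s powr z)"
      by (simp add: N_def)
    also have "\<dots> \<le> (\<Sum>i\<in>I t. 3 powr z * (a t powr z + a i powr z + dist_to_set d (x i) C powr z))"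
      by (intro sum_mono each)
    also have "\<dots> = 3 powr z * (N t * a t powr z + (\<Sum>i\<in>I t. a i powr z)
        + (\<Sum>i\<in>I t. dist_to_set d (x i) C powr z))"
      by (simp add: N_def sum.distrib flip: sum_distrib_left)
    also have "\<dots> \<le> 3 powr z * (N t * a t powr z + (\<rho> + 1) * S)"
      using IA IS AS by (intro mult_left_mono) (auto simp: algebra_simps)
    finally have main: "s powr z \<le> 3 powr z * (a t powr z + (\<rho> + 1) * S / N t)"
      using N by (simp add: field_simps)
    have "s powr z / S \<le> 3 powr z * (\<rho> * (a t powr z / A) + (\<rho> + 1) * (1 / N t))"
    proof (cases "S = 0")
      \<comment> \<open>Here the ratio is 0 by the convention for division by zero.\<close>
      case True
      then show ?thesis
        using rho N A0 by simp
    next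
      case False
      with S0 have S: "0 < S"
        by simp
      have aA: "a t powr z / S \<le> \<rho> * (a t powr z / A)"
      proof (cases "A = 0")
        \<comment> \<open>\<open>a t powr z\<close> is a summand of \<open>A\<close>, so it vanishes
          and both sides are 0.\<close>
        case True
        have "a t powr z \<le> A"
          unfolding A_def a_def by (rule member_le_sum) (use tm in auto)
        then show ?thesis
          using True by simp
      next
        case False
        with A0 have "0 < A"
          by simp
        then show ?thesis
          using S mult_left_mono[OF AS, of "a t powr z"] by (simp add: field_simps)
      qed
      have "s powr z / S \<le> 3 powr z * (a t powr z + (\<rho> + 1) * S / N t) / S"
        using main S by (intro divide_right_mono) auto
      also have "\<dots> = 3 powr z * (a t powr z / S + (\<rho> + 1) * (1 / N t))"
        using S N by (simp add: field_simps)
      also have "\<dots> \<le> 3 powr z * (\<rho> * (a t powr z / A) + (\<rho> + 1) * (1 / N t))"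
        using aA by (intro mult_left_mono) auto
      finally show ?thesis .
    qed
    then show "dist_to_set d (x t) C powr z / (\<Sum>i=1..t. dist_to_set d (x i) C powr z)
        \<le> 3 powr z * (\<rho> * (a t powr z / A) + (\<rho> + 1) * (1 / N t))"
      by (simp add: s_def S_def)
  qed
  have "(\<Sum>t\<in>T. online_sensitivity d k z x t)
      \<le> (\<Sum>t\<in>T. 3 powr z * (\<rho> * (a t powr z / A) + (\<rho> + 1) * (1 / N t)))"
    by (intro sum_mono pointwise)
  \<comment> \<open>Enlarging \<open>T\<close> to all times up to \<open>m\<close> only adds
    nonnegative terms; the first parts then run over the full cost \<open>A\<close>, the second over
    complete rank sums.\<close>
  also have "\<dots> \<le> (\<Sum>t=1..m. 3 powr z * (\<rho> * (a t powr z / A) + (\<rho> + 1) * (1 / N t)))"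
    using T rho A0 by (intro sum_mono2) (auto simp: N_def)
  also have "\<dots> = 3 powr z * (\<rho> * ((\<Sum>t=1..m. a t powr z) / A) + (\<rho> + 1) * (\<Sum>t=1..m. 1 / N t))"
    by (simp only: sum.distrib sum_divide_distrib sum_distrib_left distrib_left)
  also have "\<dots> \<le> 3 powr z * (\<rho> * 1 + (\<rho> + 1) * (real k * (1 + ln (real m))))"
  proof (intro mult_left_mono add_mono)
    show "(\<Sum>t=1..m. a t powr z) / A \<le> 1"
      by (simp add: A_def a_def)
    show "(\<Sum>t=1..m. 1 / N t) \<le> real k * (1 + ln (real m))"
      unfolding N_def I_def
      using D c(1) m by (intro sum_inverse_rank_le[of D]) (auto simp: center_sets_def)
  qed (use rho in auto)
  finally show ?thesis
    by simp
qed

section \<open>Separation and diameter of the grid\<close>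

lemma eucl_dist_grid_ge_1:
  assumes x: "x \<in> grid d \<Delta>" and y: "y \<in> grid d \<Delta>" and "x \<noteq> y"
  shows "1 \<le> eucl_dist d x y"
proof -
  obtain i where i: "x i \<noteq> y i"
    using \<open>x \<noteq> y\<close> by blast
  have id: "i < d"
  proof (rule ccontr)
    assume "\<not> i < d"
    then have "x i = 0" "y i = 0"
      using x y by (simp_all add: grid_def topspace_Euclidean_space)
    with i show False
      by simp
  qed
  have "x i \<in> real ` {1..\<Delta>}" "y i \<in> real ` {1..\<Delta>}"
    using x y id by (auto simp: grid_def)
  then obtain p q :: nat where pq: "x i = real p" "y i = real q"
    by auto
  have "1 \<le> \<bar>x i - y i\<bar>"
    using i unfolding pq by (cases p q rule: linorder_cases) auto
  also have "\<dots> = L2_set (\<lambda>i. x i - y i) {i}"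
    by simp
  also have "\<dots> \<le> L2_set (\<lambda>i. x i - y i) {..<d}"
    unfolding L2_set_def using id by (intro real_sqrt_le_mono sum_mono2) auto
  finally show ?thesis
    by (simp add: eucl_dist_def)
qed

text \<open>The sum of the coordinate differences dominates the Euclidean norm. The loss of a factor
  \<open>sqrt d\<close> is harmless, since the bound is only used inside a logarithm.\<close>

lemma eucl_dist_grid_le:
  assumes x: "x \<in> grid d \<Delta>" and y: "y \<in> grid d \<Delta>"
  shows "eucl_dist d x y \<le> real d * real \<Delta>"
proof -
  have "\<bar>x i - y i\<bar> \<le> real \<Delta>" if "i < d" for i
  proof -
    have "x i \<in> real ` {1..\<Delta>}" "y i \<in> real ` {1..\<Delta>}"
      using x y \<open>i < d\<close> by (auto simp: grid_def)
    then obtain p q :: nat where "x i = real p" "y i = real q" "p \<le> \<Delta>" "q \<le> \<Delta>"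
      by auto
    then show ?thesis
      by auto
  qed
  then have "(\<Sum>i<d. \<bar>x i - y i\<bar>) \<le> (\<Sum>i<d. real \<Delta>)"
    by (intro sum_mono) auto
  then show ?thesis
    using L2_set_le_sum_abs[of "\<lambda>i. x i - y i" "{..<d}"] by (simp add: eucl_dist_def)
qed

text \<open>Among more than \<open>k\<close> distinct points two share a nearest center. They are at
  least 1 apart, so one of them is at distance at least 1/2 from that center and alone costs
  \<open>(1/2) powr z\<close>.\<close>

lemma card_grid_le_if_cost_less:
  fixes x :: "nat \<Rightarrow> nat \<Rightarrow> real"
  assumes C: "C \<in> center_sets d k" and z: "0 \<le> z"
    and x: "\<And>i. i \<in> {1..t} \<Longrightarrow> x i \<in> grid d \<Delta>"
    and cost: "(\<Sum>i=1..t. dist_to_set d (x i) C powr z) < (1/2) powr z"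
  shows "card (x ` {1..t}) \<le> k"
proof (rule ccontr)
  assume "\<not> ?thesis"
  then have more: "card C < card (x ` {1..t})"
    using C by (auto simp: center_sets_def)
  have "\<forall>p. \<exists>y. y \<in> C \<and> dist_to_set d p C = eucl_dist d p y"
    by (metis C dist_to_set_attained)
  then obtain c where c: "\<And>p. c p \<in> C" "\<And>p. dist_to_set d p C = eucl_dist d p (c p)"
    by metis
  have "\<not> inj_on c (x ` {1..t})"
    using more c(1) C by (intro pigeonhole) (auto simp: center_sets_def
        intro: le_less_trans[OF card_mono[of C]])
  then obtain i j where ij: "i \<in> {1..t}" "j \<in> {1..t}" "x i \<noteq> x j" "c (x i) = c (x j)"
    by (auto simp: inj_on_def)
  have "1 \<le> eucl_dist d (x i) (x j)"
    using ij x by (intro eucl_dist_grid_ge_1) auto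
  also have "\<dots> \<le> dist_to_set d (x i) C + dist_to_set d (x j) C"
    using eucl_dist_triangle[of d "x i" "x j" "c (x j)"] ij
      eucl_dist_commute[of d "c (x j)" "x j"] by (simp add: c(2))
  finally obtain l where l: "l \<in> {1..t}" "1/2 \<le> dist_to_set d (x l) C"
    using ij by (metis add_mono_thms_linordered_field(5) field_sum_of_halves linorder_not_less)
  have "(1/2) powr z \<le> dist_to_set d (x l) C powr z"
    using l z by (intro powr_mono2) auto
  also have "\<dots> \<le> (\<Sum>i=1..t. dist_to_set d (x i) C powr z)"
    using l by (intro member_le_sum) auto
  finally show False
    using cost by simp
qed

section \<open>Phases of the clustering cost\<close>

theorem theorem1p3:
  "\<exists>K::real. K > 0 \<and>
     (\<forall>(n::nat) (d::nat) (\<Delta>::nat) (k::nat) (z::real) (x::nat \<Rightarrow> nat \<Rightarrow> real).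
        n \<ge> 1 \<longrightarrow> d \<ge> 1 \<longrightarrow> \<Delta> \<ge> 1 \<longrightarrow> n * d * \<Delta> \<ge> 2 \<longrightarrow> k \<ge> 1 \<longrightarrow> z \<ge> 1 \<longrightarrow>
        (\<forall>t\<in>{1..n}. x t \<in> grid d \<Delta>) \<longrightarrow>
        (\<Sum>t=1..n. online_sensitivity d k z x t)
          \<le> K * (2 powr (2 * z) * real k * (ln (real (n * d * \<Delta>)))\<^sup>2))"
\<comment> \<open>The constant is \<open>96 = 12 * 8\<close>: at most \<open>12 * L\<close> phases,
  each contributing at most \<open>3 powr z * (8 * G * k * L)\<close>.\<close>
proof (intro exI[of _ 96] conjI allI impI)
  fix n d \<Delta> k :: nat and z :: real and x :: "nat \<Rightarrow> nat \<Rightarrow> real"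
  assume n: "n \<ge> 1" and d: "d \<ge> 1" and \<Delta>: "\<Delta> \<ge> 1" and ge2: "n * d * \<Delta> \<ge> 2"
    and k: "k \<ge> 1" and z: "z \<ge> 1" and grid: "\<forall>t\<in>{1..n}. x t \<in> grid d \<Delta>"
  define L where "L = ln (real (n * d * \<Delta>))"
  define G :: real where "G = (4/3) powr z"
  define cost where "cost t C = (\<Sum>i=1..t. dist_to_set d (x i) C powr z)" for t C
  \<comment> \<open>A witness below the threshold stands in for the optimal cost, so that no
    minimizer is required.\<close>
  define small where
    "small t p \<longleftrightarrow> (\<exists>C\<in>center_sets d k. cost t C < (1/2) powr z * G ^ p)" for t and p :: nat
  define phase where "phase t = (LEAST p. small t p)" for t
  define P where "P = nat \<lfloor>8 * L\<rfloor> + 1"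
  have cost0: "0 \<le> cost t C" for t C
    unfolding cost_def by (intro sum_nonneg) auto
  have G: "1 \<le> G"
    using z by (auto simp: G_def intro: ge_one_powr_ge_zero)
  have L_sum: "L = ln n + ln d + ln \<Delta>"
    using n d \<Delta> by (simp add: L_def ln_mult)
  have "ln 2 \<le> L"
    unfolding L_def using ge2 by (subst ln_le_cancel_iff) linarith+
  moreover have "(1/2::real) \<le> ln 2"
    using ln_le_minus_one[of "1/2::real"] by (simp add: ln_div)
  ultimately have L: "1/2 \<le> L" "ln 2 \<le> L"
    by auto
  have P: "8 * L < P" "P \<le> 8 * L + 1"
    using L unfolding P_def by linarith+
  have small_P: "small t P" if t: "t \<in> {1..n}" for t
  proof -
    \<comment> \<open>A single input point as center already gives a sufficient upper bound for the
      optimal cost.\<close>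
    have C: "{x 1} \<in> center_sets d k"
      using grid n k by (auto simp: center_sets_def grid_def)
    have "cost t {x 1} \<le> (\<Sum>i=1..t. (real d * real \<Delta>) powr z)"
      unfolding cost_def dist_to_set_def using t grid n z
      by (intro sum_mono powr_mono2) (auto intro!: eucl_dist_grid_le simp: eucl_dist_nonneg)
    also have "\<dots> \<le> n * (real d * real \<Delta>) powr z"
      using t by (auto intro!: mult_right_mono)
    also have "\<dots> = exp (ln n + z * (ln d + ln \<Delta>))"
      using n d \<Delta> by (simp add: exp_add powr_def ln_mult)
    \<comment> \<open>Since \<open>ln (4/3) \<ge> 1/4\<close> and \<open>P > 8 * L\<close>, the
      positive term exceeds \<open>2 * z * L\<close>. One \<open>z * L\<close> covers the exponent
      on the left, because \<open>z \<ge> 1\<close>; the other covers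
      \<open>z * ln 2\<close>.\<close>
    also have "\<dots> < exp (real P * (z * ln (4/3)) - z * ln 2)"
    proof -
      have "1/4 \<le> ln (4/3::real)"
        using ln_le_minus_one[of "3/4::real"] by (simp add: ln_div)
      then have "real P * z * (1/4) \<le> real P * z * ln (4/3)"
        using z by (intro mult_left_mono) auto
      moreover have "z * (2 * L) < z * (real P * (1/4))"
        using P z by (intro mult_strict_left_mono) auto
      moreover have "1 * ln n \<le> z * ln n"
        using z n by (intro mult_right_mono) auto
      moreover have "z * (ln n + ln d + ln \<Delta> + ln 2) \<le> z * (2 * L)"
        using L z by (intro mult_left_mono) (auto simp: L_sum)
      ultimately show ?thesis
        by (simp add: algebra_simps)
    qed
    also have "\<dots> = (1/2) powr z * G ^ P"
      by (simp add: G_def powr_def exp_diff ln_div exp_minus exp_of_nat_mult divide_simps)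
    finally show ?thesis
      using C unfolding small_def by blast
  qed
  have phase_small: "small t (phase t)" if "t \<in> {1..n}" for t
    unfolding phase_def using small_P[OF that] by (rule LeastI)
  have phase_le: "phase t \<le> P" if "t \<in> {1..n}" for t
    unfolding phase_def using small_P[OF that] by (rule Least_le)
  have phase_bound: "(\<Sum>t\<in>{t\<in>{1..n}. phase t = p}. online_sensitivity d k z x t)
      \<le> 3 powr z * (8 * G * k * L)" for p
  proof (cases "{t\<in>{1..n}. phase t = p} = {}")
    case True
    then show ?thesis
      using G L by (simp only: sum.empty) simp
  next
    case False
    let ?T = "{t\<in>{1..n}. phase t = p}"
    define m where "m = Max ?T"
    have mT: "m \<in> ?T"
      unfolding m_def using False by (intro Max_in) auto
    have T: "?T \<subseteq> {1..m}"
      unfolding m_def by auto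
    obtain D where D: "D \<in> center_sets d k"
      and opt: "\<And>t C. t \<in> ?T \<Longrightarrow> C \<in> center_sets d k \<Longrightarrow> cost m D \<le> G * cost t C"
    proof (cases p)
      \<comment> \<open>A cost below \<open>2\<^sup>-\<^sup>z\<close> forces at most \<open>k\<close> distinct points, which can serve as centers.\<close>
      case 0
      then obtain C where C: "C \<in> center_sets d k" "cost m C < (1/2) powr z"
        using phase_small[of m] mT by (auto simp: small_def)
      have "card (x ` {1..m}) \<le> k"
        using C z mT grid by (intro card_grid_le_if_cost_less[of C d k z]) (auto simp: cost_def)
      then have D: "x ` {1..m} \<in> center_sets d k"
        using mT grid by (auto simp: center_sets_def grid_def)
      have "dist_to_set d (x i) (x ` {1..m}) = 0" if "i \<in> {1..m}" for i
        using dist_to_set_le[OF D, of "x i" "x i"] dist_to_set_nonneg[OF D, of "x i"] that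
        by (simp add: eucl_dist_def L2_set_def)
      then have "cost m (x ` {1..m}) = 0"
        by (simp add: cost_def)
      then show ?thesis
        using that[OF D] G cost0 by simp
    next
      case (Suc q)
      obtain D where D: "D \<in> center_sets d k" "cost m D < (1/2) powr z * G ^ p"
        using phase_small[of m] mT by (auto simp: small_def)
      have "cost m D \<le> G * cost t C" if t: "t \<in> ?T" and C: "C \<in> center_sets d k" for t C
      proof -
        \<comment> \<open>Minimality of the phase: every \<open>C\<close> costs at least the
          threshold of \<open>q = p - 1\<close>, while \<open>D\<close> lies below the next one,
          larger by the factor \<open>G\<close>.\<close>
        have "\<not> small t q"
          using t Suc by (intro not_less_Least) (auto simp flip: phase_def)
        then have "(1/2) powr z * G ^ q \<le> cost t C"
          using C by (auto simp: small_def not_less)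
        then have "G * ((1/2) powr z * G ^ q) \<le> G * cost t C"
          using G by (intro mult_left_mono) auto
        then show ?thesis
          using D(2) Suc by (simp add: mult_ac)
      qed
      then show ?thesis
        using that D(1) by blast
    qed
    have m1: "1 \<le> m" "m \<le> n"
      using mT by auto
    have "(\<Sum>t\<in>?T. online_sensitivity d k z x t)
        \<le> 3 powr z * (G + (G + 1) * (real k * (1 + ln (real m))))"
      using D T m1 G z opt
      by (intro sum_online_sensitivity_le[of D]) (auto simp: cost_def)
    also have "\<dots> \<le> 3 powr z * (8 * G * k * L)"
    proof (intro mult_left_mono)
      have "ln m \<le> ln n" "0 \<le> ln d" "0 \<le> ln \<Delta>"
        using m1 d \<Delta> by auto
      \<comment> \<open>Use \<open>1 \<le> 2 * L\<close> and \<open>ln m \<le> L\<close>. Together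
        with \<open>G + 1 \<le> 2 * G\<close> this makes the second summand at most
        \<open>6 * G * k * L\<close>; the first adds \<open>2 * G * k * L\<close>.\<close>
      then have "1 + ln m \<le> 3 * L"
        using L by (simp add: L_sum)
      then have "(G + 1) * (real k * (1 + ln m)) \<le> (2 * G) * (real k * (3 * L))"
        using G L m1 by (intro mult_mono) auto
      moreover have "G * 1 \<le> G * (real k * (2 * L))"
        using G L k mult_mono[of 1 "real k" 1 "2 * L"] by (intro mult_left_mono) auto
      ultimately show "G + (G + 1) * (real k * (1 + ln m)) \<le> 8 * G * k * L"
        by simp
    qed auto
    finally show ?thesis .
  qed
  have "(\<Sum>t=1..n. online_sensitivity d k z x t)
      = (\<Sum>p\<le>P. \<Sum>t\<in>{t\<in>{1..n}. phase t = p}. online_sensitivity d k z x t)"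
    using phase_le by (intro sum.group[symmetric]) auto
  also have "\<dots> \<le> (\<Sum>p\<le>P. 3 powr z * (8 * G * k * L))"
    by (intro sum_mono phase_bound)
  also have "\<dots> = (real P + 1) * (3 powr z * (8 * G * k * L))"
    by (simp add: algebra_simps)
  \<comment> \<open>The phases are numbered from 0 to \<open>P\<close>, and
    \<open>P + 1 \<le> 8 * L + 2 \<le> 12 * L\<close>.\<close>
  also have "\<dots> \<le> (12 * L) * (3 powr z * (8 * G * k * L))"
    using P L G by (intro mult_right_mono) auto
  also have "\<dots> = 96 * ((3 powr z * G) * real k * L\<^sup>2)"
    by (simp add: power2_eq_square)
  also have "3 powr z * G = 4 powr z"
    by (simp add: G_def flip: powr_mult)
  also have "\<dots> = 2 powr (2 * z)"
    by (simp flip: powr_powr)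
  finally show "(\<Sum>t=1..n. online_sensitivity d k z x t)
      \<le> 96 * (2 powr (2 * z) * real k * (ln (real (n * d * \<Delta>)))\<^sup>2)"
    by (simp add: L_def)
qed simp

end
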